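(* Let $n,k,d\ge1$ and let $H$ be an $n$-qubit $k$-local Hamiltonian with bounded degree $d$. Then $$\frac13\,C(k,d)\,\|H\|_{\mathrm{Pauli},1}\le\|H\|,\qquad C(k,d)=\frac{\sqrt{2(k!)}}{\sqrt d\;k^{\,k+2.5}\,(2\sqrt6+4\sqrt3)^k}.$$
   Context: An $n$-qubit $k$-local Hamiltonian with bounded degree $d$ is a Hermitian operator that can be written as a sum of $k$-qubit observables (Hermitian operators each acting nontrivially on at most $k$ qubits) such that each qubit is acted on by at most $d$ of them. $\|H\|$ is the spectral norm. Writing $H=\sum_{P\in\{I,X,Y,Z\}^{\otimes n}}\alpha_P P$ in the Pauli basis, $\|H\|_{\mathrm{Pauli},1}=\sum_P|\alpha_P|$. *)

theory Defs
  imports "HOL-Analysis.Analysis"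
begin

text \<open>
  The qubits are the elements of a finite type \<open>'q\<close>, so \<open>n = CARD('q)\<close>. The computational basis
  of the \<open>2 ^ n\<close>-dimensional state space is indexed by the bit strings \<open>'q \<Rightarrow> bool\<close>, with \<open>False\<close>
  for \<open>|0>\<close> and \<open>True\<close> for \<open>|1>\<close>.
\<close>

type_synonym 'q qop = "complex ^ ('q \<Rightarrow> bool) ^ ('q \<Rightarrow> bool)"

definition hermitian :: "complex ^ 'i ^ 'i \<Rightarrow> bool" where
  "hermitian A \<longleftrightarrow> map_matrix cnj (transpose A) = A"

abbreviation spectral_norm :: "complex ^ 'i ^ 'j \<Rightarrow> real" where
  "spectral_norm A \<equiv> onorm (\<lambda>v. A *v v)"

text \<open>
  \<open>A\<close> acts trivially on the qubit \<open>q\<close> if it is the tensor product of the identity on \<open>q\<close> with an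
  operator \<open>B\<close> on the other qubits, whose basis states are the bit strings restricted to \<open>- {q}\<close>.
\<close>

definition acts_trivially_on :: "'q::finite qop \<Rightarrow> 'q \<Rightarrow> bool" where
  "acts_trivially_on A q \<longleftrightarrow>
     (\<exists>B. \<forall>x y. A $ x $ y = of_bool (x q = y q) * B (restrict x (- {q})) (restrict y (- {q})))"

definition op_support :: "'q::finite qop \<Rightarrow> 'q set" where
  "op_support A = {q. \<not> acts_trivially_on A q}"

definition local_hamiltonian :: "nat \<Rightarrow> nat \<Rightarrow> 'q::finite qop \<Rightarrow> bool" where
  "local_hamiltonian k d H \<longleftrightarrow> hermitian H \<and>
     (\<exists>(m::nat) h. H = (\<Sum>j<m. h j) \<and>
        (\<forall>j<m. hermitian (h j) \<and> card (op_support (h j)) \<le> k) \<and>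
        (\<forall>q. card {j. j < m \<and> q \<in> op_support (h j)} \<le> d))"

datatype pauli = PI | PX | PY | PZ

lemma UNIV_pauli: "UNIV = {PI, PX, PY, PZ}"
  using pauli.exhaust by blast

instance pauli :: finite
  by standard (simp add: UNIV_pauli)

fun pauli_matrix :: "pauli \<Rightarrow> complex ^ bool ^ bool" where
  "pauli_matrix PI = mat 1"
| "pauli_matrix PX = (\<chi> a b. of_bool (a \<noteq> b))"
| "pauli_matrix PY = (\<chi> a b. if a = b then 0 else if a then \<i> else - \<i>)"
| "pauli_matrix PZ = (\<chi> a b. if a \<noteq> b then 0 else if a then - 1 else 1)"

text \<open>The tensor product of the single-qubit matrices, written out entrywise.\<close>

definition pauli_op :: "('q::finite \<Rightarrow> pauli) \<Rightarrow> 'q qop" where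
  "pauli_op P = (\<chi> x y. \<Prod>q\<in>UNIV. pauli_matrix (P q) $ x q $ y q)"

definition pauli_expansion :: "'q::finite qop \<Rightarrow> (('q \<Rightarrow> pauli) \<Rightarrow> complex) \<Rightarrow> bool" where
  "pauli_expansion A \<alpha> \<longleftrightarrow> A = (\<Sum>P\<in>UNIV. map_matrix ((*) (\<alpha> P)) (pauli_op P))"

text \<open>The description is well defined by lemma \<open>ex1_pauli_expansion\<close> below.\<close>

definition pauli_coeff :: "'q::finite qop \<Rightarrow> ('q \<Rightarrow> pauli) \<Rightarrow> complex" where
  "pauli_coeff A = (THE \<alpha>. pauli_expansion A \<alpha>)"

definition pauli_norm1 :: "'q::finite qop \<Rightarrow> real" where
  "pauli_norm1 A = (\<Sum>P\<in>UNIV. cmod (pauli_coeff A P))"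

definition pauli_const :: "nat \<Rightarrow> nat \<Rightarrow> real" where
  "pauli_const k d =
     sqrt (2 * fact k) /
     (sqrt (real d) * real k powr (real k + 5 / 2) * (2 * sqrt 6 + 4 * sqrt 3) ^ k)"

lemma sum_prod_fun:
  fixes f :: "'q::finite \<Rightarrow> 'b::finite \<Rightarrow> 'c::comm_semiring_1"
  shows "(\<Sum>g\<in>UNIV. \<Prod>q\<in>UNIV. f q (g q)) = (\<Prod>q\<in>UNIV. \<Sum>b\<in>UNIV. f q b)"
  using prod_sum_PiE[of "UNIV :: 'q set" "\<lambda>_. UNIV" f] by simp

lemma pauli_matrix_complete:
  "(\<Sum>p\<in>UNIV. pauli_matrix p $ a $ b * pauli_matrix p $ c $ d) = 2 * of_bool (a = d \<and> b = c)"
  by (cases a; cases b; cases c; cases d) (simp_all add: UNIV_pauli mat_def)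

lemma pauli_matrix_orthogonal:
  "(\<Sum>a\<in>UNIV. \<Sum>b\<in>UNIV. pauli_matrix p $ a $ b * pauli_matrix r $ b $ a) = 2 * of_bool (p = r)"
  by (cases p; cases r) (simp_all add: UNIV_bool mat_def)

lemma prod_of_bool_eq:
  "(\<Prod>q\<in>(UNIV::'q::finite set). 2 * of_bool (f q = g q) :: complex)
     = 2 ^ CARD('q) * of_bool (f = g)"
  by (auto simp: prod.distrib fun_eq_iff)

lemma pauli_op_complete:
  fixes x y u v :: "'q::finite \<Rightarrow> bool"
  shows "(\<Sum>P\<in>UNIV. pauli_op P $ x $ y * pauli_op P $ u $ v)
           = 2 ^ CARD('q) * of_bool (x = v \<and> y = u)"
proof -
  have "(\<Sum>P\<in>UNIV. pauli_op P $ x $ y * pauli_op P $ u $ v)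
      = (\<Prod>q\<in>UNIV. \<Sum>p\<in>UNIV. pauli_matrix p $ x q $ y q * pauli_matrix p $ u q $ v q)"
    by (simp add: pauli_op_def prod.distrib[symmetric]
        sum_prod_fun[of "\<lambda>q p. pauli_matrix p $ x q $ y q * pauli_matrix p $ u q $ v q"])
  also have "\<dots> = (\<Prod>q\<in>UNIV. 2 * of_bool ((x q, y q) = (v q, u q)))"
    by (simp add: pauli_matrix_complete)
  also have "\<dots> = 2 ^ CARD('q) * of_bool ((\<lambda>q. (x q, y q)) = (\<lambda>q. (v q, u q)))"
    by (rule prod_of_bool_eq)
  also have "((\<lambda>q. (x q, y q)) = (\<lambda>q. (v q, u q))) \<longleftrightarrow> x = v \<and> y = u"
    by (auto simp: fun_eq_iff)
  finally show ?thesis .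
qed

lemma pauli_op_orthogonal:
  fixes P R :: "'q::finite \<Rightarrow> pauli"
  shows "(\<Sum>x\<in>UNIV. \<Sum>y\<in>UNIV. pauli_op P $ x $ y * pauli_op R $ y $ x)
           = 2 ^ CARD('q) * of_bool (P = R)"
proof -
  have "(\<Sum>x\<in>UNIV. \<Sum>y\<in>UNIV. pauli_op P $ x $ y * pauli_op R $ y $ x)
      = (\<Sum>x\<in>UNIV. \<Prod>q\<in>UNIV. \<Sum>b\<in>UNIV. pauli_matrix (P q) $ x q $ b * pauli_matrix (R q) $ b $ x q)"
  proof (rule sum.cong)
    fix x :: "'q \<Rightarrow> bool"
    show "(\<Sum>y\<in>UNIV. pauli_op P $ x $ y * pauli_op R $ y $ x)
      = (\<Prod>q\<in>UNIV. \<Sum>b\<in>UNIV. pauli_matrix (P q) $ x q $ b * pauli_matrix (R q) $ b $ x q)"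
      by (simp add: pauli_op_def prod.distrib[symmetric] del: UNIV_bool
          flip: sum_prod_fun[of "\<lambda>q b. pauli_matrix (P q) $ x q $ b * pauli_matrix (R q) $ b $ x q"])
  qed simp
  also have "\<dots> = (\<Prod>q\<in>UNIV. \<Sum>a\<in>UNIV. \<Sum>b\<in>UNIV. pauli_matrix (P q) $ a $ b * pauli_matrix (R q) $ b $ a)"
    by (rule sum_prod_fun)
  also have "\<dots> = 2 ^ CARD('q) * of_bool (P = R)"
    unfolding pauli_matrix_orthogonal by (rule prod_of_bool_eq)
  finally show ?thesis .
qed

lemma pauli_expansion_entry:
  "pauli_expansion A \<alpha> \<longleftrightarrow> (\<forall>x y. A $ x $ y = (\<Sum>P\<in>UNIV. \<alpha> P * pauli_op P $ x $ y))"
  by (simp add: pauli_expansion_def vec_eq_iff sum_component)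

lemma pauli_expansion_iff:
  fixes A :: "'q::finite qop"
  shows "pauli_expansion A \<alpha> \<longleftrightarrow> \<alpha> = (\<lambda>P. trace (A ** pauli_op P) / 2 ^ CARD('q))"
proof -
  have tr: "trace (A ** pauli_op P) = (\<Sum>u\<in>UNIV. \<Sum>v\<in>UNIV. A $ u $ v * pauli_op P $ v $ u)" for P
    by (simp add: trace_def matrix_matrix_mult_def)
  show ?thesis
  proof
    assume *: "pauli_expansion A \<alpha>"
    show "\<alpha> = (\<lambda>P. trace (A ** pauli_op P) / 2 ^ CARD('q))"
    proof
      fix P
      have "trace (A ** pauli_op P)
          = (\<Sum>u\<in>UNIV. \<Sum>v\<in>UNIV. \<Sum>R\<in>UNIV. \<alpha> R * (pauli_op R $ u $ v * pauli_op P $ v $ u))"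
        using * by (simp add: tr pauli_expansion_entry sum_distrib_right mult.assoc)
      also have "\<dots> = (\<Sum>u\<in>UNIV. \<Sum>R\<in>UNIV. \<Sum>v\<in>UNIV. \<alpha> R * (pauli_op R $ u $ v * pauli_op P $ v $ u))"
        by (intro sum.cong refl sum.swap)
      also have "\<dots> = (\<Sum>R\<in>UNIV. \<Sum>u\<in>UNIV. \<Sum>v\<in>UNIV. \<alpha> R * (pauli_op R $ u $ v * pauli_op P $ v $ u))"
        by (rule sum.swap)
      also have "\<dots> = (\<Sum>R\<in>UNIV. \<alpha> R * (2 ^ CARD('q) * of_bool (R = P)))"
        by (simp only: sum_distrib_left[symmetric] pauli_op_orthogonal)
      also have "\<dots> = (\<Sum>R\<in>UNIV. if R = P then \<alpha> R * 2 ^ CARD('q) else 0)"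
        by (intro sum.cong refl) auto
      also have "\<dots> = 2 ^ CARD('q) * \<alpha> P"
        by simp
      finally show "\<alpha> P = trace (A ** pauli_op P) / 2 ^ CARD('q)" by simp
    qed
  next
    assume \<alpha>: "\<alpha> = (\<lambda>P. trace (A ** pauli_op P) / 2 ^ CARD('q))"
    show "pauli_expansion A \<alpha>"
      unfolding pauli_expansion_entry
    proof (intro allI)
      fix x y
      have "2 ^ CARD('q) * (\<Sum>P\<in>UNIV. \<alpha> P * pauli_op P $ x $ y)
          = (\<Sum>P\<in>UNIV. trace (A ** pauli_op P) * pauli_op P $ x $ y)"
        unfolding sum_distrib_left \<alpha> by (intro sum.cong refl) simp
      also have "\<dots> = (\<Sum>P\<in>UNIV. \<Sum>u\<in>UNIV. \<Sum>v\<in>UNIV. A $ u $ v * (pauli_op P $ v $ u * pauli_op P $ x $ y))"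
        by (simp add: tr sum_distrib_right mult.assoc)
      also have "\<dots> = (\<Sum>u\<in>UNIV. \<Sum>P\<in>UNIV. \<Sum>v\<in>UNIV. A $ u $ v * (pauli_op P $ v $ u * pauli_op P $ x $ y))"
        by (rule sum.swap)
      also have "\<dots> = (\<Sum>u\<in>UNIV. \<Sum>v\<in>UNIV. \<Sum>P\<in>UNIV. A $ u $ v * (pauli_op P $ v $ u * pauli_op P $ x $ y))"
        by (intro sum.cong refl sum.swap)
      also have "\<dots> = (\<Sum>u\<in>UNIV. \<Sum>v\<in>UNIV. A $ u $ v * (2 ^ CARD('q) * of_bool (v = y \<and> u = x)))"
        by (simp only: sum_distrib_left[symmetric] pauli_op_complete)
      also have "\<dots> = (\<Sum>u\<in>UNIV. \<Sum>v\<in>UNIV. if v = y then if u = x then A $ u $ v * 2 ^ CARD('q) else 0 else 0)"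
        by (intro sum.cong refl) auto
      also have "\<dots> = 2 ^ CARD('q) * A $ x $ y"
        by simp
      finally show "A $ x $ y = (\<Sum>P\<in>UNIV. \<alpha> P * pauli_op P $ x $ y)" by simp
    qed
  qed
qed

lemma ex1_pauli_expansion: "\<exists>!\<alpha>. pauli_expansion A \<alpha>"
  by (simp add: pauli_expansion_iff)

end

theory Submission
  imports Defs
begin

text \<open>
  Evaluated in the pure product states whose Bloch vectors are \<open>(\<plusminus>1, \<plusminus>1, \<plusminus>1) / sqrt 3\<close>, the Hamiltonian
  becomes a multilinear polynomial of degree at most \<open>k\<close> in \<open>3 n\<close> signs that is bounded by the spectral
  norm; by convexity the bound extends to the whole cube. The monomial of \<open>P\<close> has coefficient
  \<open>\<alpha>\<^sub>P / sqrt 3 ^ |P|\<close>, and each variable occurs in at most \<open>D = 4 ^ k d\<close> monomials.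

  For such a polynomial, split the variables into a random half \<open>A\<close> and its complement. Scaling the
  variables in \<open>A\<close> by \<open>t \<in> [-1, 1]\<close> gives a bounded polynomial in \<open>t\<close>, whose linear coefficient is
  therefore bounded. With the best signs on \<open>A\<close> that coefficient is \<open>\<Sum>v\<in>A. |Q\<^sub>v|\<close>, where \<open>Q\<^sub>v\<close> collects
  the monomials meeting \<open>A\<close> in \<open>v\<close> only. Averaged over random signs off \<open>A\<close>, \<open>|Q\<^sub>v|\<close> is at least
  \<open>3 ^ - (k - 1)\<close> times the \<open>l\<^sup>2\<close> norm of the coefficients of \<open>Q\<^sub>v\<close> (Bonami's fourth moment inequality),
  hence at least \<open>3 ^ - (k - 1) / sqrt D\<close> times their \<open>l\<^sup>1\<close> norm. A nonempty monomial of degree at most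
  \<open>k\<close> meets \<open>A\<close> in exactly one variable with probability at least \<open>2 ^ - k\<close>.
\<close>

subsection \<open>Multilinear polynomials on the cube\<close>

lemma sum_Pow_insert:
  assumes "finite V" and "a \<notin> V"
  shows "(\<Sum>X\<in>Pow (insert a V). f X) = (\<Sum>X\<in>Pow V. f X + f (insert a X))"
proof -
  have "inj_on (insert a) (Pow V)"
    using assms(2) by (auto simp: inj_on_def)
  moreover have "Pow V \<inter> insert a ` Pow V = {}"
    using assms(2) by auto
  ultimately show ?thesis
    using assms(1) by (simp add: Pow_insert sum.union_disjoint sum.reindex sum.distrib)
qed

text \<open>Coefficients are indexed by all sets, but only subsets of \<open>V\<close> are read, so
  \<open>c\<close> can stay fixed while an induction shrinks \<open>V\<close>.\<close>

definition multilinear :: "'v set \<Rightarrow> ('v set \<Rightarrow> real) \<Rightarrow> ('v \<Rightarrow> real) \<Rightarrow> real" where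
  "multilinear V c x = (\<Sum>S\<in>Pow V. c S * (\<Prod>v\<in>S. x v))"

text \<open>A vertex of the cube is encoded by the set of its \<open>+1\<close> coordinates.
  Averages over uniform signs on \<open>V\<close> thus become sums over \<open>Pow V\<close> divided
  by \<open>2 ^ card V\<close>.\<close>

definition sign_vec :: "'v set \<Rightarrow> 'v \<Rightarrow> real" where
  "sign_vec X v = (if v \<in> X then 1 else - 1)"

lemma multilinear_cong:
  assumes "\<And>v. v \<in> V \<Longrightarrow> x v = y v"
  shows "multilinear V c x = multilinear V c y"
  unfolding multilinear_def using assms
  by (intro sum.cong refl arg_cong2[where f = "(*)"] prod.cong) auto

lemma multilinear_insert:
  assumes "finite V" and "a \<notin> V"
  shows "multilinear (insert a V) c x
    = multilinear V c x + x a * multilinear V (\<lambda>S. c (insert a S)) x"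
proof -
  have "(\<Prod>v\<in>insert a S. x v) = x a * (\<Prod>v\<in>S. x v)" if "S \<in> Pow V" for S
    using that assms by (subst prod.insert) (auto intro: finite_subset)
  then show ?thesis
    unfolding multilinear_def sum_Pow_insert[OF assms] sum.distrib sum_distrib_left
    by (auto intro!: sum.cong)
qed

text \<open>The polynomial is affine in the new variable, \<open>R + x a * T\<close>, so the two
  signs give \<open>R - T\<close> and \<open>R + T\<close>. The function \<open>f\<close> stays
  general to serve both the second and the fourth moment.\<close>

lemma sum_multilinear_insert:
  assumes "finite V" and "a \<notin> V"
  shows "(\<Sum>X\<in>Pow (insert a V). f (multilinear (insert a V) c (sign_vec X)))
    = (\<Sum>X\<in>Pow V. f (multilinear V c (sign_vec X) - multilinear V (\<lambda>S. c (insert a S)) (sign_vec X))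
        + f (multilinear V c (sign_vec X) + multilinear V (\<lambda>S. c (insert a S)) (sign_vec X)))"
proof -
  have "multilinear V c' (sign_vec (insert a X)) = multilinear V c' (sign_vec X)" for c' X
    using assms(2) by (intro multilinear_cong) (auto simp: sign_vec_def)
  moreover have "a \<notin> X" if "X \<in> Pow V" for X
    using that assms(2) by auto
  ultimately show ?thesis
    unfolding sum_Pow_insert[OF assms] multilinear_insert[OF assms]
    by (intro sum.cong refl) (simp add: sign_vec_def)
qed

section \<open>Moments over random signs\<close>

text \<open>Distinct monomials are orthogonal over the cube; in the induction this is the
  parallelogram law for \<open>R - T\<close> and \<open>R + T\<close>.\<close>

lemma multilinear_Parseval:
  assumes "finite V"
  shows "(\<Sum>X\<in>Pow V. (multilinear V c (sign_vec X))\<^sup>2) = 2 ^ card V * (\<Sum>S\<in>Pow V. (c S)\<^sup>2)"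
  using assms
proof (induction V arbitrary: c)
  case empty
  then show ?case by (simp add: multilinear_def)
next
  case (insert a V)
  have parallelogram: "(r - t)\<^sup>2 + (r + t)\<^sup>2 = 2 * r\<^sup>2 + 2 * t\<^sup>2" for r t :: real
    by algebra
  show ?case
    unfolding sum_multilinear_insert[OF insert.hyps, of "\<lambda>y. y\<^sup>2"] sum_Pow_insert[OF insert.hyps]
      parallelogram
    by (simp add: sum.distrib insert.IH insert.hyps ring_distribs flip: sum_distrib_left)
qed

text \<open>The weights \<open>3 ^ card S\<close> make the induction close. The average of the
  fourth powers of \<open>R - T\<close> and \<open>R + T\<close> is
  \<open>R ^ 4 + 6 * R\<^sup>2 * T\<^sup>2 + T ^ 4\<close>, Cauchy-Schwarz bounds the mixed moment
  by \<open>r * t\<close>, and \<open>r\<^sup>2 + 6 * r * t + t\<^sup>2\<close> is at most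
  \<open>(r + 3 * t)\<^sup>2\<close>.\<close>

lemma multilinear_fourth_moment:
  assumes "finite V"
  shows "(\<Sum>X\<in>Pow V. (multilinear V c (sign_vec X)) ^ 4)
    \<le> 2 ^ card V * (\<Sum>S\<in>Pow V. 3 ^ card S * (c S)\<^sup>2)\<^sup>2"
  using assms
proof (induction V arbitrary: c)
  case empty
  then show ?case by (simp add: multilinear_def power_mult_distrib)
next
  case (insert a V)
  define R T where "R = multilinear V c" and "T = multilinear V (\<lambda>S. c (insert a S))"
  define r t where "r = (\<Sum>S\<in>Pow V. 3 ^ card S * (c S)\<^sup>2)"
    and "t = (\<Sum>S\<in>Pow V. 3 ^ card S * (c (insert a S))\<^sup>2)"
  define N :: real where "N = 2 ^ card V"
  have nonneg: "r \<ge> 0" "t \<ge> 0" "N \<ge> 0"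
    by (auto simp: r_def t_def N_def intro!: sum_nonneg)
  have R4: "(\<Sum>X\<in>Pow V. (R (sign_vec X)) ^ 4) \<le> N * r\<^sup>2"
    and T4: "(\<Sum>X\<in>Pow V. (T (sign_vec X)) ^ 4) \<le> N * t\<^sup>2"
    unfolding R_def T_def r_def t_def N_def by (rule insert.IH)+
  have "(\<Sum>X\<in>Pow V. (R (sign_vec X))\<^sup>2 * (T (sign_vec X))\<^sup>2)\<^sup>2
      \<le> (\<Sum>X\<in>Pow V. ((R (sign_vec X))\<^sup>2)\<^sup>2) * (\<Sum>X\<in>Pow V. ((T (sign_vec X))\<^sup>2)\<^sup>2)"
    by (rule Cauchy_Schwarz_ineq_sum)
  also have "\<dots> \<le> (N * r\<^sup>2) * (N * t\<^sup>2)"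
    using R4 T4 nonneg by (intro mult_mono) (auto intro!: sum_nonneg)
  also have "\<dots> = (N * r * t)\<^sup>2"
    by algebra
  finally have RT: "(\<Sum>X\<in>Pow V. (R (sign_vec X))\<^sup>2 * (T (sign_vec X))\<^sup>2) \<le> N * r * t"
    using nonneg by (simp add: power2_le_iff_abs_le)
  have binom: "(u - v) ^ 4 + (u + v) ^ 4 = 2 * u ^ 4 + 12 * (u\<^sup>2 * v\<^sup>2) + 2 * v ^ 4" for u v :: real
    by algebra
  have "(\<Sum>X\<in>Pow (insert a V). (multilinear (insert a V) c (sign_vec X)) ^ 4)
      = 2 * (\<Sum>X\<in>Pow V. (R (sign_vec X)) ^ 4)
        + 12 * (\<Sum>X\<in>Pow V. (R (sign_vec X))\<^sup>2 * (T (sign_vec X))\<^sup>2)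
        + 2 * (\<Sum>X\<in>Pow V. (T (sign_vec X)) ^ 4)"
    unfolding sum_multilinear_insert[OF insert.hyps, of "\<lambda>y. y ^ 4"] R_def[symmetric] T_def[symmetric] binom
    by (simp add: sum.distrib sum_distrib_left)
  also have "\<dots> \<le> 2 * (N * r\<^sup>2) + 12 * (N * r * t) + 2 * (N * t\<^sup>2)"
    using R4 T4 RT by linarith
  also have "\<dots> = 2 * N * (r + 3 * t)\<^sup>2 - 16 * N * t\<^sup>2"
    by algebra
  also have "\<dots> \<le> 2 * N * (r + 3 * t)\<^sup>2"
    using nonneg by simp
  also have "r + 3 * t = (\<Sum>S\<in>Pow (insert a V). 3 ^ card S * (c S)\<^sup>2)"
  proof -
    have "card (insert a S) = Suc (card S)" if "S \<in> Pow V" for S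
      using that insert.hyps by (subst card_insert_disjoint) (auto intro: finite_subset)
    then show ?thesis
      unfolding sum_Pow_insert[OF insert.hyps] r_def t_def sum.distrib sum_distrib_left
      by (auto intro!: sum.cong)
  qed
  finally show ?case
    using insert.hyps by (simp add: N_def)
qed

text \<open>A small fourth moment prevents the second moment from sitting on few points, so the
  first moment cannot be much smaller than the \<open>l\<^sup>2\<close> norm.\<close>

lemma multilinear_abs_moment:
  assumes "finite V" and deg: "\<And>S. S \<subseteq> V \<Longrightarrow> c S \<noteq> 0 \<Longrightarrow> card S \<le> m"
  shows "2 ^ card V * sqrt (\<Sum>S\<in>Pow V. (c S)\<^sup>2)
    \<le> 3 ^ m * (\<Sum>X\<in>Pow V. \<bar>multilinear V c (sign_vec X)\<bar>)"
proof (cases "(\<Sum>S\<in>Pow V. (c S)\<^sup>2) = 0")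
  case True
  then show ?thesis by (simp add: sum_nonneg)
next
  case False
  define Q where "Q X = multilinear V c (sign_vec X)" for X
  define s where "s = sqrt (\<Sum>S\<in>Pow V. (c S)\<^sup>2)"
  \<comment> \<open>The square of \<open>l\<close> is the quotient of the fourth moment bound
    \<open>9 ^ m * s ^ 4\<close> by the second moment \<open>s\<^sup>2\<close>.\<close>
  define l where "l = 3 ^ m * s"
  have s: "s > 0" and s2: "(\<Sum>S\<in>Pow V. (c S)\<^sup>2) = s\<^sup>2"
    using False by (auto simp: s_def sum_nonneg less_le)
  then have l: "l > 0"
    by (simp add: l_def)
  \<comment> \<open>The difference of the two sides has a double root at
    \<open>\<bar>y\<bar> = l\<close>. Averaging the inequality gives at least
    \<open>3 * l\<^sup>2 * s\<^sup>2 - l\<^sup>2 * s\<^sup>2\<close> on the right, hence a first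
    moment of at least \<open>s\<^sup>2 / l = s / 3 ^ m\<close>.\<close>
  have tangent: "\<bar>y\<bar> * (2 * l ^ 3) \<ge> 3 * l\<^sup>2 * y\<^sup>2 - y ^ 4" for y :: real
  proof -
    have "0 \<le> \<bar>y\<bar> * (\<bar>y\<bar> - l)\<^sup>2 * (\<bar>y\<bar> + 2 * l)"
      using l by (intro mult_nonneg_nonneg) auto
    also have "\<dots> = \<bar>y\<bar> ^ 4 - 3 * l\<^sup>2 * \<bar>y\<bar>\<^sup>2 + 2 * l ^ 3 * \<bar>y\<bar>"
      by algebra
    finally show ?thesis by (simp add: mult_ac)
  qed
  have "(\<Sum>S\<in>Pow V. 3 ^ card S * (c S)\<^sup>2) \<le> (\<Sum>S\<in>Pow V. 3 ^ m * (c S)\<^sup>2)"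
  proof (rule sum_mono)
    fix S assume "S \<in> Pow V"
    then show "3 ^ card S * (c S)\<^sup>2 \<le> 3 ^ m * (c S)\<^sup>2"
      using deg[of S] by (cases "c S = 0") (auto intro!: mult_right_mono power_increasing)
  qed
  also have "\<dots> = 3 ^ m * s\<^sup>2"
    by (simp add: s2 flip: sum_distrib_left)
  finally have "(\<Sum>S\<in>Pow V. 3 ^ card S * (c S)\<^sup>2)\<^sup>2 \<le> (3 ^ m * s\<^sup>2)\<^sup>2"
    by (intro power_mono sum_nonneg) auto
  also have "(3 ^ m * s\<^sup>2)\<^sup>2 = l\<^sup>2 * s\<^sup>2"
    by (simp add: l_def power_mult_distrib power2_eq_square)
  finally have Q4: "(\<Sum>X\<in>Pow V. (Q X) ^ 4) \<le> 2 ^ card V * (l\<^sup>2 * s\<^sup>2)"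
    using multilinear_fourth_moment[OF assms(1), of c] unfolding Q_def
    by (meson mult_left_mono order_trans zero_le_numeral zero_le_power)
  have Q2: "(\<Sum>X\<in>Pow V. (Q X)\<^sup>2) = 2 ^ card V * s\<^sup>2"
    using multilinear_Parseval[OF assms(1), of c] by (simp add: Q_def s2)
  have "2 * l\<^sup>2 * (2 ^ card V * s\<^sup>2) \<le> 3 * l\<^sup>2 * (\<Sum>X\<in>Pow V. (Q X)\<^sup>2) - (\<Sum>X\<in>Pow V. (Q X) ^ 4)"
    using Q4 unfolding Q2 by (simp add: mult_ac)
  also have "\<dots> = (\<Sum>X\<in>Pow V. 3 * l\<^sup>2 * (Q X)\<^sup>2 - (Q X) ^ 4)"
    by (simp add: sum_subtractf sum_distrib_left)
  also have "\<dots> \<le> (\<Sum>X\<in>Pow V. \<bar>Q X\<bar> * (2 * l ^ 3))"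
    by (intro sum_mono tangent)
  also have "\<dots> = (2 * l\<^sup>2 * s) * (3 ^ m * (\<Sum>X\<in>Pow V. \<bar>Q X\<bar>))"
    unfolding sum_distrib_right[symmetric] l_def by (simp add: power3_eq_cube power2_eq_square)
  finally have "(2 * l\<^sup>2 * s) * (2 ^ card V * s) \<le> (2 * l\<^sup>2 * s) * (3 ^ m * (\<Sum>X\<in>Pow V. \<bar>Q X\<bar>))"
    by (simp add: power2_eq_square mult_ac)
  then show ?thesis
    using l s by (simp add: Q_def s_def)
qed

section \<open>Linear coefficients of bounded polynomials\<close>

text \<open>Combining the values at \<open>t\<close> and \<open>t / 2\<close> cancels the top term
  and keeps the linear coefficient, at the cost of a factor 3 in the bound; \<open>m\<close> rounds
  leave a linear function.\<close>

lemma odd_polynomial_linear_coeff: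
  fixes c :: "nat \<Rightarrow> real"
  assumes "\<And>t. \<bar>t\<bar> \<le> 1 \<Longrightarrow> \<bar>\<Sum>i\<le>m. c i * t ^ (2 * i + 1)\<bar> \<le> M"
  shows "\<bar>c 0\<bar> \<le> 3 ^ m * M"
  using assms
proof (induction m arbitrary: c M)
  case 0
  from 0[of 1] show ?case by simp
next
  case (Suc m)
  define p where "p t = (\<Sum>i\<le>Suc m. c i * t ^ (2 * i + 1))" for t
  \<comment> \<open>Halving the argument divides the term of degree \<open>2 * m + 3\<close> by
    \<open>2 * w\<close>, and it turns the linear coefficient of the combination into
    \<open>w - 1\<close> times the old one, whence the denominator of \<open>c'\<close>.\<close>
  define w :: real where "w = 4 ^ Suc m"
  have w: "w \<ge> 4"
    using one_le_power[of "4::real" m] by (simp add: w_def)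
  define c' where "c' i = c i * (2 * w * (1 / 2) ^ (2 * i + 1) - 1) / (w - 1)" for i
  \<comment> \<open>\<open>2 * w * p (t / 2) - p t\<close> has no term of degree \<open>2 * m + 3\<close>.\<close>
  have c'0: "c' 0 = c 0"
    using w by (simp add: c'_def)
  have "2 * w * (1 / 2) ^ (2 * Suc m + 1) = (1::real)"
    by (simp add: w_def power_mult power_divide)
  then have c'Suc: "c' (Suc m) = 0"
    unfolding c'_def by simp
  have "(\<Sum>i\<le>m. c' i * t ^ (2 * i + 1)) = (2 * w * p (t / 2) - p t) / (w - 1)" for t
  proof -
    have "(\<Sum>i\<le>m. c' i * t ^ (2 * i + 1)) = (\<Sum>i\<le>Suc m. c' i * t ^ (2 * i + 1))"
      by (simp add: c'Suc)
    also have "\<dots> = (2 * w * p (t / 2) - p t) / (w - 1)"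
      unfolding p_def sum_distrib_left sum_divide_distrib sum_subtractf[symmetric] c'_def
      by (intro sum.cong refl) (simp add: power_divide field_simps)
    finally show ?thesis .
  qed
  moreover have "\<bar>(2 * w * p (t / 2) - p t) / (w - 1)\<bar> \<le> 3 * M" if "\<bar>t\<bar> \<le> 1" for t
  proof -
    have p1: "\<bar>p (t / 2)\<bar> \<le> M" and p2: "\<bar>p t\<bar> \<le> M"
      using Suc.prems[of t] Suc.prems[of "t / 2"] that by (auto simp: p_def)
    have "\<bar>2 * w * p (t / 2) - p t\<bar> \<le> 2 * w * \<bar>p (t / 2)\<bar> + \<bar>p t\<bar>"
      using w abs_triangle_ineq4[of "2 * w * p (t / 2)" "p t"] by (simp add: abs_mult)
    also have "\<dots> \<le> 2 * w * M + M"
      using w p1 p2 by (intro add_mono mult_left_mono) auto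
    \<comment> \<open>The inequality \<open>2 * w + 1 \<le> 3 * (w - 1)\<close> is exactly
      \<open>w \<ge> 4\<close>.\<close>
    also have "\<dots> \<le> 3 * M * (w - 1)"
      using mult_right_mono[OF w, of M] p1 by (simp add: algebra_simps)
    finally show ?thesis
      using w by (simp add: abs_divide pos_divide_le_eq)
  qed
  ultimately have "\<bar>c' 0\<bar> \<le> 3 ^ m * (3 * M)"
    by (intro Suc.IH) simp
  then show ?case
    by (simp add: c'0 mult_ac)
qed

text \<open>The odd part \<open>(p t - p (- t)) / 2\<close> obeys the same bound and has the same
  linear coefficient; the exponent \<open>(k - 1) div 2\<close> counts its possible terms above
  degree 1.\<close>

lemma polynomial_linear_coeff:
  fixes c :: "nat \<Rightarrow> real"
  assumes "k \<ge> 1" and bound: "\<And>t. \<bar>t\<bar> \<le> 1 \<Longrightarrow> \<bar>\<Sum>j\<le>k. c j * t ^ j\<bar> \<le> M"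
  shows "\<bar>c 1\<bar> \<le> 3 ^ ((k - 1) div 2) * M"
proof -
  have "\<bar>\<Sum>i\<le>(k - 1) div 2. c (2 * i + 1) * t ^ (2 * i + 1)\<bar> \<le> M" if "\<bar>t\<bar> \<le> 1" for t
  proof -
    let ?p = "\<lambda>t. \<Sum>j\<le>k. c j * t ^ j"
    have "(\<Sum>i\<le>(k - 1) div 2. c (2 * i + 1) * t ^ (2 * i + 1)) = (\<Sum>j\<in>{j\<in>{..k}. odd j}. c j * t ^ j)"
      using \<open>k \<ge> 1\<close>
      by (intro sum.reindex_bij_witness[of _ "\<lambda>j. j div 2" "\<lambda>i. 2 * i + 1"]) (auto elim!: oddE)
    also have "\<dots> = (\<Sum>j\<le>k. (c j * t ^ j - c j * (- t) ^ j) / 2)"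
      unfolding sum.inter_filter[OF finite_atMost]
      by (intro sum.cong refl) auto
    also have "\<dots> = (?p t - ?p (- t)) / 2"
      by (simp add: sum_subtractf flip: sum_divide_distrib)
    finally show ?thesis
      using bound[of t] bound[of "- t"] that by auto
  qed
  from odd_polynomial_linear_coeff[of "\<lambda>i. c (2 * i + 1)", OF this] show ?thesis by simp
qed

text \<open>Freezing \<open>x a\<close> at \<open>s\<close> leaves a multilinear polynomial in the
  other variables. Its vertex values \<open>R + s * T\<close> are convex combinations of
  \<open>R + T\<close> and \<open>R - T\<close>, which are values at vertices of the larger
  cube.\<close>

lemma multilinear_cube_bound:
  assumes "finite V"
    and "\<And>X. X \<subseteq> V \<Longrightarrow> \<bar>multilinear V c (sign_vec X)\<bar> \<le> M"
    and "\<And>v. v \<in> V \<Longrightarrow> \<bar>x v\<bar> \<le> 1"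
  shows "\<bar>multilinear V c x\<bar> \<le> M"
  using assms
proof (induction V arbitrary: c)
  case empty
  then show ?case by (simp add: multilinear_def)
next
  case (insert a V)
  define R T where "R = multilinear V c" and "T = multilinear V (\<lambda>S. c (insert a S))"
  define s where "s = x a"
  have comb: "multilinear V (\<lambda>S. c S + s * c (insert a S)) y = R y + s * T y" for y
    by (simp add: R_def T_def multilinear_def distrib_right sum.distrib sum_distrib_left mult.assoc)
  have "\<bar>multilinear V (\<lambda>S. c S + s * c (insert a S)) x\<bar> \<le> M"
  proof (rule insert.IH)
    fix X assume X: "X \<subseteq> V"
    let ?r = "R (sign_vec X)" and ?t = "T (sign_vec X)"
    have "sign_vec X a = - 1" "sign_vec (insert a X) a = 1"
      using X insert.hyps by (auto simp: sign_vec_def)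
    moreover have "multilinear V c' (sign_vec (insert a X)) = multilinear V c' (sign_vec X)" for c'
      using insert.hyps by (intro multilinear_cong) (auto simp: sign_vec_def)
    ultimately have "\<bar>?r - ?t\<bar> \<le> M" "\<bar>?r + ?t\<bar> \<le> M"
      using insert.prems(1)[of X] insert.prems(1)[of "insert a X"] X
      by (auto simp: multilinear_insert[OF insert.hyps] R_def T_def)
    moreover have "\<bar>s\<bar> \<le> 1"
      using insert.prems(2) by (simp add: s_def)
    ultimately have "(1 + s) * \<bar>?r + ?t\<bar> + (1 - s) * \<bar>?r - ?t\<bar> \<le> (1 + s) * M + (1 - s) * M"
      by (intro add_mono mult_left_mono) auto
    moreover have "2 * (?r + s * ?t) = (1 + s) * (?r + ?t) + (1 - s) * (?r - ?t)"
      by (simp add: algebra_simps)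
    then have "2 * \<bar>?r + s * ?t\<bar> \<le> (1 + s) * \<bar>?r + ?t\<bar> + (1 - s) * \<bar>?r - ?t\<bar>"
      using \<open>\<bar>s\<bar> \<le> 1\<close> abs_triangle_ineq[of "(1 + s) * (?r + ?t)" "(1 - s) * (?r - ?t)"]
        abs_mult[of 2 "?r + s * ?t"]
      by (simp add: abs_mult del: distrib_left_numeral)
    ultimately show "\<bar>multilinear V (\<lambda>S. c S + s * c (insert a S)) (sign_vec X)\<bar> \<le> M"
      unfolding comb by (simp add: algebra_simps)
  qed (use insert.prems in auto)
  then show ?case
    unfolding comb by (simp add: multilinear_insert[OF insert.hyps] R_def T_def s_def)
qed

lemma multilinear_linear_part:
  fixes c :: "'v::finite set \<Rightarrow> real"
  assumes "k \<ge> 1" and deg: "\<And>S. c S \<noteq> 0 \<Longrightarrow> card S \<le> k"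
    and bound: "\<And>X. \<bar>multilinear UNIV c (sign_vec X)\<bar> \<le> M"
  shows "(\<Sum>v\<in>A. \<bar>multilinear (- A) (\<lambda>S. c (insert v S)) (sign_vec X)\<bar>) \<le> 3 ^ ((k - 1) div 2) * M"
proof -
  define Q where "Q v = multilinear (- A) (\<lambda>S. c (insert v S)) (sign_vec X)" for v
  \<comment> \<open>These signs turn \<open>y v * Q v\<close> into \<open>\<bar>Q v\<bar>\<close>.
    Where \<open>Q v = 0\<close> the entry is 0, which still lies in the cube.\<close>
  define y where "y v = (if v \<in> A then sgn (Q v) else sign_vec X v)" for v
  \<comment> \<open>\<open>C j\<close> is the coefficient of \<open>t ^ j\<close> once the variables
    in \<open>A\<close> are scaled by \<open>t\<close>.\<close>
  define C where "C j = (\<Sum>S\<in>{S \<in> {S. c S \<noteq> 0}. card (S \<inter> A) = j}. c S * (\<Prod>v\<in>S. y v))" for j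
  have "\<bar>\<Sum>j\<le>k. C j * t ^ j\<bar> \<le> M" if t: "\<bar>t\<bar> \<le> 1" for t
  proof -
    define x where "x v = (if v \<in> A then t else 1) * y v" for v
    have "(\<Sum>j\<le>k. C j * t ^ j)
        = (\<Sum>j\<le>k. \<Sum>S\<in>{S \<in> {S. c S \<noteq> 0}. card (S \<inter> A) = j}. c S * (\<Prod>v\<in>S. y v) * t ^ card (S \<inter> A))"
      unfolding C_def sum_distrib_right by (intro sum.cong refl) auto
    also have "\<dots> = (\<Sum>S\<in>{S. c S \<noteq> 0}. c S * (\<Prod>v\<in>S. y v) * t ^ card (S \<inter> A))"
    proof (rule sum.group)
      show "(\<lambda>S. card (S \<inter> A)) ` {S. c S \<noteq> 0} \<subseteq> {..k}"
        using deg by (auto intro: order_trans[OF card_mono[OF finite Int_lower1]])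
    qed auto
    also have "\<dots> = (\<Sum>S\<in>{S. c S \<noteq> 0}. c S * (\<Prod>v\<in>S. x v))"
      by (intro sum.cong refl)
        (simp add: x_def prod.distrib mult_ac flip: prod.inter_restrict[OF finite])
    also have "\<dots> = multilinear UNIV c x"
      unfolding multilinear_def by (intro sum.mono_neutral_left) auto
    also have "\<bar>\<dots>\<bar> \<le> M"
    proof (rule multilinear_cube_bound)
      show "\<bar>x v\<bar> \<le> 1" for v
        using t by (auto simp: x_def y_def sign_vec_def sgn_if)
    qed (use bound in auto)
    finally show ?thesis .
  qed
  then have "\<bar>C 1\<bar> \<le> 3 ^ ((k - 1) div 2) * M"
    by (rule polynomial_linear_coeff[OF \<open>k \<ge> 1\<close>])
  also have "C 1 = (\<Sum>S\<in>{S. card (S \<inter> A) = 1}. c S * (\<Prod>v\<in>S. y v))"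
    unfolding C_def by (intro sum.mono_neutral_left) auto
  also have "\<dots> = (\<Sum>(v, S)\<in>A \<times> Pow (- A). c (insert v S) * (\<Prod>v\<in>insert v S. y v))"
  \<comment> \<open>A set meeting \<open>A\<close> in one variable corresponds to the pair of that
    variable and the remainder, which lies off \<open>A\<close>.\<close>
  proof (rule sum.reindex_bij_witness[of _ "\<lambda>(v, S). insert v S" "\<lambda>S. (the_elem (S \<inter> A), S - A)"])
    fix S assume "S \<in> {S. card (S \<inter> A) = 1}"
    then obtain v where v: "S \<inter> A = {v}"
      by (auto simp: card_1_singleton_iff)
    then show "(case (the_elem (S \<inter> A), S - A) of (v, S) \<Rightarrow> insert v S) = S"
      and "(the_elem (S \<inter> A), S - A) \<in> A \<times> Pow (- A)"
      by auto
    then show "(case (the_elem (S \<inter> A), S - A) of (v, S) \<Rightarrow> c (insert v S) * (\<Prod>v\<in>insert v S. y v))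
        = c S * (\<Prod>v\<in>S. y v)"
      by simp
  next
    fix p assume "p \<in> A \<times> Pow (- A)"
    then obtain v S where p: "p = (v, S)" "v \<in> A" "S \<subseteq> - A"
      by auto
    then have "insert v S \<inter> A = {v}" "insert v S - A = S"
      by blast+
    then show "(case p of (v, S) \<Rightarrow> insert v S) \<in> {S. card (S \<inter> A) = 1}"
      and "(the_elem ((case p of (v, S) \<Rightarrow> insert v S) \<inter> A), (case p of (v, S) \<Rightarrow> insert v S) - A) = p"
      unfolding p(1) prod.case by simp_all
  qed
  also have "\<dots> = (\<Sum>v\<in>A. \<Sum>S\<in>Pow (- A). y v * (c (insert v S) * (\<Prod>v\<in>S. sign_vec X v)))"
    unfolding sum.cartesian_product[symmetric]
  proof (intro sum.cong refl)
    fix v S assume "v \<in> A" "S \<in> Pow (- A)"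
    then have "v \<notin> S" "(\<Prod>v\<in>S. y v) = (\<Prod>v\<in>S. sign_vec X v)"
      by (auto simp: y_def intro!: prod.cong)
    then show "c (insert v S) * (\<Prod>v\<in>insert v S. y v) = y v * (c (insert v S) * (\<Prod>v\<in>S. sign_vec X v))"
      by simp
  qed
  also have "\<dots> = (\<Sum>v\<in>A. \<bar>Q v\<bar>)"
    unfolding sum_distrib_left[symmetric] multilinear_def[symmetric]
    by (intro sum.cong refl) (simp add: y_def abs_sgn Q_def mult.commute)
  finally show ?thesis
    by (simp add: Q_def)
qed

text \<open>Cauchy-Schwarz on the nonzero terms. Through this bound the sparsity \<open>D\<close>
  enters the estimate.\<close>

lemma sum_abs_le_sqrt_card:
  fixes f :: "'a \<Rightarrow> real"
  assumes "finite Z" and "card {z \<in> Z. f z \<noteq> 0} \<le> D"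
  shows "(\<Sum>z\<in>Z. \<bar>f z\<bar>) \<le> sqrt D * sqrt (\<Sum>z\<in>Z. (f z)\<^sup>2)"
proof -
  let ?Y = "{z \<in> Z. f z \<noteq> 0}"
  have "(\<Sum>z\<in>Z. \<bar>f z\<bar>)\<^sup>2 = (\<Sum>z\<in>?Y. 1 * \<bar>f z\<bar>)\<^sup>2"
    using assms(1) by (intro arg_cong[where f = "\<lambda>t. t\<^sup>2"] sum.mono_neutral_cong_right) auto
  also have "\<dots> \<le> (\<Sum>z\<in>?Y. 1\<^sup>2) * (\<Sum>z\<in>?Y. \<bar>f z\<bar>\<^sup>2)"
    by (rule Cauchy_Schwarz_ineq_sum)
  also have "\<dots> \<le> D * (\<Sum>z\<in>Z. (f z)\<^sup>2)"
  proof (rule mult_mono)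
    show "(\<Sum>z\<in>?Y. \<bar>f z\<bar>\<^sup>2) \<le> (\<Sum>z\<in>Z. (f z)\<^sup>2)"
      unfolding power2_abs by (rule sum_mono2) (use assms(1) in auto)
  qed (use assms(2) in \<open>auto intro!: sum_nonneg\<close>)
  finally show ?thesis
    by (simp add: real_le_rsqrt flip: real_sqrt_mult)
qed

section \<open>Summing over splits of the variables\<close>

text \<open>The bound on the linear part is summed over all signs off \<open>A\<close>. Removing
  \<open>v\<close> lowers the degree to \<open>k - 1\<close>, so the first moment costs
  \<open>3 ^ (k - 1)\<close>; passing from \<open>l\<^sup>2\<close> to \<open>l\<^sup>1\<close>
  costs \<open>sqrt D\<close>.\<close>

lemma multilinear_split_coeff_sum:
  fixes c :: "'v::finite set \<Rightarrow> real"
  assumes "k \<ge> 1" and deg: "\<And>S. c S \<noteq> 0 \<Longrightarrow> card S \<le> k"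
    and sparse: "\<And>v. card {S. v \<in> S \<and> c S \<noteq> 0} \<le> D"
    and bound: "\<And>X. \<bar>multilinear UNIV c (sign_vec X)\<bar> \<le> M"
  shows "(\<Sum>v\<in>A. \<Sum>S\<in>Pow (- A). \<bar>c (insert v S)\<bar>)
    \<le> sqrt D * 3 ^ (k - 1) * 3 ^ ((k - 1) div 2) * M"
proof -
  define Q where "Q v X = multilinear (- A) (\<lambda>S. c (insert v S)) (sign_vec X)" for v X
  define \<sigma> where "\<sigma> v = sqrt (\<Sum>S\<in>Pow (- A). (c (insert v S))\<^sup>2)" for v
  define N :: real where "N = 2 ^ card (- A)"
  have "N * (\<Sum>v\<in>A. \<sigma> v) \<le> (\<Sum>v\<in>A. 3 ^ (k - 1) * (\<Sum>X\<in>Pow (- A). \<bar>Q v X\<bar>))"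
    unfolding sum_distrib_left
  proof (rule sum_mono)
    fix v assume v: "v \<in> A"
    have "card S \<le> k - 1" if "S \<subseteq> - A" "c (insert v S) \<noteq> 0" for S
    proof -
      have "v \<notin> S"
        using v that by auto
      then show ?thesis
        using deg[OF that(2)] by simp
    qed
    then show "N * \<sigma> v \<le> (\<Sum>X\<in>Pow (- A). 3 ^ (k - 1) * \<bar>Q v X\<bar>)"
      using multilinear_abs_moment[of "- A" "\<lambda>S. c (insert v S)" "k - 1"]
      by (simp add: N_def \<sigma>_def Q_def sum_distrib_left)
  qed
  also have "\<dots> = 3 ^ (k - 1) * (\<Sum>X\<in>Pow (- A). \<Sum>v\<in>A. \<bar>Q v X\<bar>)"
    unfolding sum_distrib_left[symmetric] by (subst sum.swap) simp
  also have "\<dots> \<le> 3 ^ (k - 1) * (\<Sum>X\<in>Pow (- A). 3 ^ ((k - 1) div 2) * M)"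
    unfolding Q_def
    by (intro mult_left_mono sum_mono multilinear_linear_part[OF assms(1) deg bound]) auto
  also have "\<dots> = N * (3 ^ (k - 1) * 3 ^ ((k - 1) div 2) * M)"
    by (simp add: N_def card_Pow)
  finally have \<sigma>: "(\<Sum>v\<in>A. \<sigma> v) \<le> 3 ^ (k - 1) * 3 ^ ((k - 1) div 2) * M"
    by (simp add: N_def)
  have "(\<Sum>v\<in>A. \<Sum>S\<in>Pow (- A). \<bar>c (insert v S)\<bar>) \<le> (\<Sum>v\<in>A. sqrt D * \<sigma> v)"
    unfolding \<sigma>_def
  proof (intro sum_mono sum_abs_le_sqrt_card)
    fix v assume "v \<in> A"
    then have "inj_on (insert v) {S \<in> Pow (- A). c (insert v S) \<noteq> 0}"
      by (intro inj_onI) (metis (no_types, lifting) ComplD PowD insert_ident mem_Collect_eq subsetD)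
    then have "card {S \<in> Pow (- A). c (insert v S) \<noteq> 0} \<le> card {S. v \<in> S \<and> c S \<noteq> 0}"
      by (rule card_inj_on_le) auto
    then show "card {S \<in> Pow (- A). c (insert v S) \<noteq> 0} \<le> D"
      using sparse[of v] by linarith
  qed simp
  also have "\<dots> \<le> sqrt D * (3 ^ (k - 1) * 3 ^ ((k - 1) div 2) * M)"
    unfolding sum_distrib_left[symmetric] using \<sigma> by (intro mult_left_mono) auto
  finally show ?thesis
    by (simp add: mult_ac)
qed

text \<open>The random split is carried out by counting all \<open>A\<close>: for a fixed
  \<open>v\<close> in \<open>S\<close>, the sets \<open>A\<close> with
  \<open>S \<inter> A = {v}\<close> number \<open>2 ^ card (- S)\<close>, a fraction of at least
  \<open>2 ^ - k\<close> of all sets when \<open>c S\<close> is nonzero.\<close>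

lemma multilinear_coeff_sum:
  fixes c :: "'v::finite set \<Rightarrow> real"
  assumes "k \<ge> 1" and deg: "\<And>S. c S \<noteq> 0 \<Longrightarrow> card S \<le> k"
    and sparse: "\<And>v. card {S. v \<in> S \<and> c S \<noteq> 0} \<le> D"
    and bound: "\<And>X. \<bar>multilinear UNIV c (sign_vec X)\<bar> \<le> M"
  shows "(\<Sum>S\<in>- {{}}. \<bar>c S\<bar>) \<le> 2 ^ k * sqrt D * 3 ^ (k - 1) * 3 ^ ((k - 1) div 2) * M"
proof -
  define B where "B = sqrt D * 3 ^ (k - 1) * 3 ^ ((k - 1) div 2) * M"
  have "(\<Sum>S\<in>- {{}}. \<Sum>Y\<in>Pow (- S). \<bar>c S\<bar>) = (\<Sum>(S, Y)\<in>(SIGMA S:- {{}}. Pow (- S)). \<bar>c S\<bar>)"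
    by (rule sum.Sigma) auto
  \<comment> \<open>A triple \<open>(A, v, S)\<close> is sent to its monomial
    \<open>insert v S\<close> and to the rest of \<open>A\<close>, which avoids that monomial.
    Conversely, any \<open>v\<close> in a nonempty \<open>S\<close> gives a preimage of
    \<open>(S, Y)\<close> with \<open>A = insert v Y\<close>.\<close>
  also have "\<dots> \<le> (\<Sum>(A, v, S)\<in>(SIGMA A:UNIV. SIGMA v:A. Pow (- A)). \<bar>c (insert v S)\<bar>)"
  proof (rule sum_le_included[where i = "\<lambda>(A, v, S). (insert v S, A - {v})"])
    show "\<forall>x\<in>SIGMA S:- {{}}. Pow (- S). \<exists>y\<in>SIGMA A:UNIV. A \<times> Pow (- A).
        (case y of (A, v, S) \<Rightarrow> (insert v S, A - {v})) = x \<and>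
        (case x of (S, Y) \<Rightarrow> \<bar>c S\<bar>) \<le> (case y of (A, v, S) \<Rightarrow> \<bar>c (insert v S)\<bar>)"
    proof
      fix x :: "'v set \<times> 'v set" assume "x \<in> (SIGMA S:- {{}}. Pow (- S))"
      then obtain S Y v where x: "x = (S, Y)" and "v \<in> S" "Y \<subseteq> - S"
        by auto
      then have "insert v (S - {v}) = S" "insert v Y - {v} = Y" "S - {v} \<subseteq> - insert v Y"
        by auto
      then show "\<exists>y\<in>SIGMA A:UNIV. A \<times> Pow (- A).
          (case y of (A, v, S) \<Rightarrow> (insert v S, A - {v})) = x \<and>
          (case x of (S, Y) \<Rightarrow> \<bar>c S\<bar>) \<le> (case y of (A, v, S) \<Rightarrow> \<bar>c (insert v S)\<bar>)"
        unfolding x by (intro bexI[of _ "(insert v Y, v, S - {v})"]) auto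
    qed
    show "\<forall>y\<in>SIGMA A:UNIV. A \<times> Pow (- A). 0 \<le> (case y of (A, v, S) \<Rightarrow> \<bar>c (insert v S)\<bar>)"
      by (simp add: case_prod_unfold)
  qed (rule finite)+
  also have "\<dots> = (\<Sum>A\<in>UNIV. \<Sum>(v, S)\<in>(SIGMA v:A. Pow (- A)). \<bar>c (insert v S)\<bar>)"
    by (rule sum.Sigma[symmetric]) auto
  also have "\<dots> = (\<Sum>A\<in>UNIV. \<Sum>v\<in>A. \<Sum>S\<in>Pow (- A). \<bar>c (insert v S)\<bar>)"
    by (intro sum.cong refl sum.Sigma[symmetric]) auto
  also have "\<dots> \<le> (\<Sum>A\<in>(UNIV :: 'v set set). B)"
    unfolding B_def by (intro sum_mono multilinear_split_coeff_sum assms)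
  also have "\<dots> = 2 ^ CARD('v) * B"
    using card_Pow[of "UNIV :: 'v set"] by simp
  finally have split: "(\<Sum>S\<in>- {{}}. 2 ^ card (- S) * \<bar>c S\<bar>) \<le> 2 ^ CARD('v) * B"
    by (simp add: card_Pow)
  have "2 ^ CARD('v) * (\<Sum>S\<in>- {{}}. \<bar>c S\<bar>) \<le> (\<Sum>S\<in>- {{}}. 2 ^ k * (2 ^ card (- S) * \<bar>c S\<bar>))"
    unfolding sum_distrib_left
  proof (rule sum_mono)
    fix S :: "'v set"
    have "CARD('v) = card S + card (- S)"
      using card_Un_disjoint[of S "- S"] by simp
    then have "(2 :: real) ^ CARD('v) \<le> 2 ^ k * 2 ^ card (- S)" if "c S \<noteq> 0"
      using deg[OF that] by (simp add: power_increasing flip: power_add)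
    then show "2 ^ CARD('v) * \<bar>c S\<bar> \<le> 2 ^ k * (2 ^ card (- S) * \<bar>c S\<bar>)"
      by (cases "c S = 0") (auto simp flip: mult.assoc)
  qed
  also have "\<dots> \<le> 2 ^ k * (2 ^ CARD('v) * B)"
    unfolding sum_distrib_left[symmetric] using split by simp
  finally show ?thesis
    by (simp add: B_def mult_ac)
qed

subsection \<open>Pauli coefficients and product states\<close>

lemma pauli_coeff_eq_trace: "pauli_coeff A P = trace (A ** pauli_op P) / 2 ^ CARD('q)"
  for A :: "'q::finite qop"
  by (simp add: pauli_coeff_def pauli_expansion_iff)

lemma pauli_coeff_entries:
  "pauli_coeff A P = (\<Sum>x\<in>UNIV. \<Sum>y\<in>UNIV. A $ x $ y * pauli_op P $ y $ x) / 2 ^ CARD('q)"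
  for A :: "'q::finite qop"
  by (simp add: pauli_coeff_eq_trace trace_def matrix_matrix_mult_def)

lemma pauli_expansion_pauli_coeff: "pauli_expansion A (pauli_coeff A)"
  by (simp add: pauli_expansion_iff pauli_coeff_eq_trace fun_eq_iff)

lemma pauli_coeff_sum: "pauli_coeff (\<Sum>j\<in>J. h j) P = (\<Sum>j\<in>J. pauli_coeff (h j) P)"
  for h :: "'j \<Rightarrow> 'q::finite qop"
proof (induction J rule: infinite_finite_induct)
  case (insert j J)
  then show ?case
    by (simp add: pauli_coeff_entries distrib_right sum.distrib add_divide_distrib)
qed (simp_all add: pauli_coeff_entries)

lemma cnj_pauli_matrix: "cnj (pauli_matrix p $ a $ b) = pauli_matrix p $ b $ a"
  by (cases p) (auto simp: mat_def)

lemma cnj_pauli_op: "cnj (pauli_op P $ x $ y) = pauli_op P $ y $ x"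
  by (simp add: pauli_op_def cnj_pauli_matrix)

lemma pauli_coeff_real:
  assumes "hermitian A"
  shows "pauli_coeff A P \<in> \<real>"
proof -
  have A: "cnj (A $ x $ y) = A $ y $ x" for x y
    using assms unfolding hermitian_def by (auto simp: vec_eq_iff transpose_def)
  have "cnj (pauli_coeff A P) = (\<Sum>x\<in>UNIV. \<Sum>y\<in>UNIV. A $ y $ x * pauli_op P $ x $ y) / 2 ^ CARD('a)"
    by (simp add: pauli_coeff_entries A cnj_pauli_op)
  also have "\<dots> = pauli_coeff A P"
    unfolding pauli_coeff_entries by (subst sum.swap) simp
  finally show ?thesis
    by (simp add: Reals_cnj_iff)
qed

definition pauli_support :: "('q \<Rightarrow> pauli) \<Rightarrow> 'q set" where
  "pauli_support P = {q. P q \<noteq> PI}"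

lemma pauli_matrix_flip_diagonal:
  "p \<noteq> PI \<Longrightarrow> pauli_matrix p $ (\<not> a) $ (\<not> a) = - pauli_matrix p $ a $ a"
  by (cases p) auto

text \<open>
  Flipping qubit \<open>q\<close> in both basis states preserves the entries of \<open>A\<close> and negates those of
  \<open>pauli_op P\<close> that matter, so the trace of the product equals its own negative.
\<close>

lemma pauli_coeff_acts_trivially:
  assumes "acts_trivially_on A q" and "P q \<noteq> PI"
  shows "pauli_coeff A P = 0"
proof -
  obtain B where B: "\<And>x y. A $ x $ y = of_bool (x q = y q) * B (restrict x (- {q})) (restrict y (- {q}))"
    using assms(1) by (auto simp: acts_trivially_on_def)
  define fl where "fl x = x(q := \<not> x q)" for x :: "'a \<Rightarrow> bool"
  have bij: "bij fl"
    by (rule o_bij[of fl]) (auto simp: fl_def)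
  have A: "A $ fl x $ fl y = A $ x $ y" for x y
  proof -
    have "restrict (fl z) (- {q}) = restrict z (- {q})" for z
      by (auto simp: fl_def restrict_def)
    then show ?thesis
      by (simp add: B) (simp add: fl_def)
  qed
  have "A $ fl x $ fl y * pauli_op P $ fl y $ fl x = - (A $ x $ y * pauli_op P $ y $ x)" for x y
  proof (cases "x q = y q")
    case True
    have "(\<Prod>r\<in>- {q}. pauli_matrix (P r) $ fl y r $ fl x r) = (\<Prod>r\<in>- {q}. pauli_matrix (P r) $ y r $ x r)"
      by (intro prod.cong refl) (auto simp: fl_def)
    moreover have "pauli_matrix (P q) $ fl y q $ fl x q = - pauli_matrix (P q) $ y q $ x q"
      using True pauli_matrix_flip_diagonal[OF assms(2)] by (simp add: fl_def)
    ultimately have "pauli_op P $ fl y $ fl x = - pauli_op P $ y $ x"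
      by (simp add: pauli_op_def prod.remove[of UNIV q] Compl_eq_Diff_UNIV)
    then show ?thesis by (simp add: A)
  next
    case False
    then have "A $ x $ y = 0"
      by (simp add: B)
    then show ?thesis by (simp add: A)
  qed
  then have "(\<Sum>x\<in>UNIV. \<Sum>y\<in>UNIV. A $ fl x $ fl y * pauli_op P $ fl y $ fl x)
      = - (\<Sum>x\<in>UNIV. \<Sum>y\<in>UNIV. A $ x $ y * pauli_op P $ y $ x)"
    by (simp add: sum_negf)
  moreover have "(\<Sum>x\<in>UNIV. \<Sum>y\<in>UNIV. A $ fl x $ fl y * pauli_op P $ fl y $ fl x)
      = (\<Sum>x\<in>UNIV. \<Sum>y\<in>UNIV. A $ x $ y * pauli_op P $ y $ x)"
    using sum.reindex_bij_betw[OF bij, of "\<lambda>x. \<Sum>y\<in>UNIV. A $ x $ y * pauli_op P $ y $ x"]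
      sum.reindex_bij_betw[OF bij, of "\<lambda>y. A $ x $ y * pauli_op P $ y $ x" for x]
    by simp
  ultimately show ?thesis
    by (simp add: pauli_coeff_entries)
qed

lemma pauli_support_subset_op_support:
  "pauli_coeff A P \<noteq> 0 \<Longrightarrow> pauli_support P \<subseteq> op_support A"
  using pauli_coeff_acts_trivially by (fastforce simp: pauli_support_def op_support_def)

lemma card_UNIV_pauli: "CARD(pauli) = 4"
  by (simp add: UNIV_pauli)

text \<open>Such a string is \<open>PI\<close> off \<open>T\<close>, so its restriction to
  \<open>T\<close> determines it.\<close>

lemma card_pauli_support_subset:
  fixes T :: "'q::finite set"
  shows "card {P. pauli_support P \<subseteq> T} \<le> 4 ^ card T"
proof -
  have "inj_on (\<lambda>P. restrict P T) {P. pauli_support P \<subseteq> T}"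
  proof (rule inj_onI)
    fix P P' :: "'q \<Rightarrow> pauli"
    assume "P \<in> {P. pauli_support P \<subseteq> T}" "P' \<in> {P. pauli_support P \<subseteq> T}"
      and eq: "restrict P T = restrict P' T"
    then have out: "P q = PI" "P' q = PI" if "q \<notin> T" for q
      using that by (auto simp: pauli_support_def)
    show "P = P'"
    proof
      fix q
      show "P q = P' q"
        using out[of q] fun_cong[OF eq, of q] by (cases "q \<in> T") simp_all
    qed
  qed
  then have "card {P. pauli_support P \<subseteq> T} \<le> card (T \<rightarrow>\<^sub>E (UNIV :: pauli set))"
    by (rule card_inj_on_le) (auto intro: finite_PiE)
  also have "\<dots> = 4 ^ card T"
    by (simp add: card_PiE card_UNIV_pauli)
  finally show ?thesis .
qed

text \<open>A nonzero coefficient of the sum is nonzero in some term, whose support then contains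
  that of the string. At most \<open>d\<close> terms act on \<open>q\<close>, and each admits at
  most \<open>4 ^ k\<close> strings.\<close>

lemma local_hamiltonian_pauli:
  fixes H :: "'q::finite qop"
  assumes "local_hamiltonian k d H"
  shows "pauli_coeff H P \<noteq> 0 \<Longrightarrow> card (pauli_support P) \<le> k"
    and "card {P. pauli_coeff H P \<noteq> 0 \<and> q \<in> pauli_support P} \<le> 4 ^ k * d"
proof -
  obtain m :: nat and h where H: "H = (\<Sum>j<m. h j)"
    and k: "\<And>j. j < m \<Longrightarrow> card (op_support (h j)) \<le> k"
    and d: "\<And>q. card {j. j < m \<and> q \<in> op_support (h j)} \<le> d"
    using assms unfolding local_hamiltonian_def by blast
  have support: "\<exists>j<m. pauli_support P \<subseteq> op_support (h j)" if "pauli_coeff H P \<noteq> 0" for P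
  proof -
    have "(\<Sum>j<m. pauli_coeff (h j) P) \<noteq> 0"
      using that by (simp add: H pauli_coeff_sum)
    then obtain j where "j < m" "pauli_coeff (h j) P \<noteq> 0"
      by (metis lessThan_iff sum.neutral)
    then show ?thesis
      using pauli_support_subset_op_support by blast
  qed
  then show "pauli_coeff H P \<noteq> 0 \<Longrightarrow> card (pauli_support P) \<le> k"
    by (meson card_mono finite k le_trans)
  let ?J = "{j. j < m \<and> q \<in> op_support (h j)}"
  have "card {P. pauli_coeff H P \<noteq> 0 \<and> q \<in> pauli_support P}
      \<le> card (\<Union>j\<in>?J. {P. pauli_support P \<subseteq> op_support (h j)})"
    using support by (intro card_mono) fastforce+
  also have "\<dots> \<le> (\<Sum>j\<in>?J. card {P. pauli_support P \<subseteq> op_support (h j)})"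
    by (rule card_UN_le) simp
  also have "\<dots> \<le> (\<Sum>j\<in>?J. 4 ^ k)"
    using k by (intro sum_mono order_trans[OF card_pauli_support_subset] power_increasing) auto
  also have "\<dots> \<le> 4 ^ k * d"
    using d[of q] by simp
  finally show "card {P. pauli_coeff H P \<noteq> 0 \<and> q \<in> pauli_support P} \<le> 4 ^ k * d" .
qed

section \<open>Expectations in product states\<close>

definition expect :: "complex ^ 'i ^ 'i \<Rightarrow> complex ^ 'i \<Rightarrow> complex" where
  "expect A v = (\<Sum>x\<in>UNIV. \<Sum>y\<in>UNIV. cnj (v $ x) * A $ x $ y * v $ y)"

text \<open>Cauchy-Schwarz for the inner product of \<open>v\<close> and
  \<open>A *v v\<close>.\<close>

lemma cmod_expect_le:
  fixes A :: "complex ^ 'i::finite ^ 'i"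
  assumes "norm v = 1"
  shows "cmod (expect A v) \<le> spectral_norm A"
proof -
  have "expect A v = (\<Sum>x\<in>UNIV. cnj (v $ x) * (A *v v) $ x)"
    by (simp add: expect_def matrix_vector_mult_def sum_distrib_left mult.assoc)
  also have "cmod \<dots> \<le> (\<Sum>x\<in>UNIV. \<bar>cmod (v $ x)\<bar> * \<bar>cmod ((A *v v) $ x)\<bar>)"
    by (rule order_trans[OF norm_sum]) (simp add: norm_mult)
  also have "\<dots> \<le> norm v * norm (A *v v)"
    unfolding norm_vec_def by (rule L2_set_mult_ineq)
  also have "\<dots> \<le> spectral_norm A"
    using onorm[OF matrix_vector_mul_bounded_linear, of A v] assms by simp
  finally show ?thesis .
qed

definition product_state :: "('q::finite \<Rightarrow> bool \<Rightarrow> complex) \<Rightarrow> complex ^ ('q \<Rightarrow> bool)" where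
  "product_state \<psi> = (\<chi> x. \<Prod>q\<in>UNIV. \<psi> q (x q))"

lemma norm_product_state:
  fixes \<psi> :: "'q::finite \<Rightarrow> bool \<Rightarrow> complex"
  assumes "\<And>q. (\<Sum>a\<in>UNIV. (cmod (\<psi> q a))\<^sup>2) = 1"
  shows "norm (product_state \<psi>) = 1"
proof -
  have "(\<Sum>x\<in>UNIV. (cmod (product_state \<psi> $ x))\<^sup>2) = (\<Sum>x\<in>UNIV. \<Prod>q\<in>UNIV. (cmod (\<psi> q (x q)))\<^sup>2)"
    by (simp add: product_state_def prod_power_distrib flip: prod_norm)
  also have "\<dots> = 1"
    by (simp only: sum_prod_fun[of "\<lambda>q a. (cmod (\<psi> q a))\<^sup>2"] assms prod.neutral_const)
  finally show ?thesis
    by (simp add: norm_vec_def L2_set_def)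
qed

lemma expect_pauli_op:
  fixes \<psi> :: "'q::finite \<Rightarrow> bool \<Rightarrow> complex"
  shows "expect (pauli_op P) (product_state \<psi>)
    = (\<Prod>q\<in>UNIV. \<Sum>a\<in>UNIV. \<Sum>b\<in>UNIV. cnj (\<psi> q a) * pauli_matrix (P q) $ a $ b * \<psi> q b)"
proof -
  have "expect (pauli_op P) (product_state \<psi>)
      = (\<Sum>x\<in>UNIV. \<Sum>y\<in>UNIV. \<Prod>q\<in>UNIV. cnj (\<psi> q (x q)) * pauli_matrix (P q) $ x q $ y q * \<psi> q (y q))"
    by (simp add: expect_def product_state_def pauli_op_def prod.distrib)
  also have "\<dots> = (\<Sum>x\<in>UNIV. \<Prod>q\<in>UNIV. \<Sum>b\<in>UNIV. cnj (\<psi> q (x q)) * pauli_matrix (P q) $ x q $ b * \<psi> q b)"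
    by (intro sum.cong refl sum_prod_fun)
  also have "\<dots> = (\<Prod>q\<in>UNIV. \<Sum>a\<in>UNIV. \<Sum>b\<in>UNIV. cnj (\<psi> q a) * pauli_matrix (P q) $ a $ b * \<psi> q b)"
    by (rule sum_prod_fun)
  finally show ?thesis .
qed

lemma expect_pauli_expansion:
  "expect A v = (\<Sum>P\<in>UNIV. pauli_coeff A P * expect (pauli_op P) v)"
proof -
  have "expect A v = (\<Sum>x\<in>UNIV. \<Sum>y\<in>UNIV. \<Sum>P\<in>UNIV. pauli_coeff A P * (cnj (v $ x) * pauli_op P $ x $ y * v $ y))"
    unfolding expect_def pauli_expansion_pauli_coeff[unfolded pauli_expansion_entry, rule_format, of A]
    by (simp add: sum_distrib_left sum_distrib_right mult_ac)
  also have "\<dots> = (\<Sum>x\<in>UNIV. \<Sum>P\<in>UNIV. \<Sum>y\<in>UNIV. pauli_coeff A P * (cnj (v $ x) * pauli_op P $ x $ y * v $ y))"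
    by (intro sum.cong refl sum.swap)
  also have "\<dots> = (\<Sum>P\<in>UNIV. \<Sum>x\<in>UNIV. \<Sum>y\<in>UNIV. pauli_coeff A P * (cnj (v $ x) * pauli_op P $ x $ y * v $ y))"
    by (rule sum.swap)
  finally show ?thesis
    by (simp add: expect_def sum_distrib_left)
qed

text \<open>The point \<open>r\<close> of the Bloch sphere belongs to the state with amplitudes
  \<open>u\<close> on \<open>|0>\<close> and \<open>(r PX + \<i> * r PY) / (2 * u)\<close> on
  \<open>|1>\<close>. Excluding the south pole keeps \<open>u\<close> positive.\<close>

lemma ex_qubit_state:
  fixes r :: "pauli \<Rightarrow> real"
  assumes "(r PX)\<^sup>2 + (r PY)\<^sup>2 + (r PZ)\<^sup>2 = 1" and "r PZ > - 1"
  shows "\<exists>\<psi>. (\<Sum>a\<in>UNIV. (cmod (\<psi> a))\<^sup>2) = 1 \<and>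
    (\<forall>p. (\<Sum>a\<in>UNIV. \<Sum>b\<in>UNIV. cnj (\<psi> a) * pauli_matrix p $ a $ b * \<psi> b) = of_real (if p = PI then 1 else r p))"
proof -
  define u where "u = sqrt ((1 + r PZ) / 2)"
  have u: "u > 0" "u\<^sup>2 = (1 + r PZ) / 2"
    using assms(2) by (auto simp: u_def)
  define x y where "x = r PX / (2 * u)" and "y = r PY / (2 * u)"
  define \<psi> where "\<psi> a = (if a then Complex x y else of_real u)" for a
  have r: "r PX = 2 * u * x" "r PY = 2 * u * y"
    using u(1) by (simp_all add: x_def y_def)
  have "(2 * u)\<^sup>2 * (x\<^sup>2 + y\<^sup>2) = (2 * u)\<^sup>2 * ((1 - r PZ) / 2)"
    using assms(1) u(2) unfolding r by algebra
  then have xy: "x\<^sup>2 + y\<^sup>2 = (1 - r PZ) / 2"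
    using u(1) by simp
  have n: "(cmod (\<psi> True))\<^sup>2 + (cmod (\<psi> False))\<^sup>2 = 1"
    using xy u by (simp add: \<psi>_def cmod_power2 add_divide_distrib[symmetric])
  have "(\<Sum>a\<in>UNIV. \<Sum>b\<in>UNIV. cnj (\<psi> a) * pauli_matrix p $ a $ b * \<psi> b) = of_real (if p = PI then 1 else r p)" for p
    using xy u(2) by (cases p) (auto simp: UNIV_bool \<psi>_def mat_def complex_eq_iff r power2_eq_square field_simps)
  then show ?thesis
    using n by (intro exI[of _ \<psi>]) (simp add: UNIV_bool)
qed

section \<open>Pauli strings as monomials\<close>

text \<open>The variables of the polynomial are pairs of a qubit and a Pauli letter. Identity
  letters contribute none, so the degree of the monomial is the weight of the string.\<close>

definition pauli_letters :: "('q \<Rightarrow> pauli) \<Rightarrow> ('q \<times> pauli) set" where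
  "pauli_letters P = (\<lambda>q. (q, P q)) ` pauli_support P"

lemma inj_pauli_letters: "inj pauli_letters"
proof (rule injI)
  fix P R :: "'a \<Rightarrow> pauli"
  assume eq: "pauli_letters P = pauli_letters R"
  have "P q = p \<and> p \<noteq> PI \<longleftrightarrow> R q = p \<and> p \<noteq> PI" for q p
    using arg_cong[OF eq, of "\<lambda>S. (q, p) \<in> S"] by (auto simp: pauli_letters_def pauli_support_def)
  then show "P = R"
    by (metis ext)
qed

lemma prod_pauli_letters:
  fixes P :: "'q::finite \<Rightarrow> pauli"
  shows "(\<Prod>v\<in>pauli_letters P. g v) = (\<Prod>q\<in>UNIV. if P q = PI then 1 else g (q, P q))"
  unfolding pauli_letters_def pauli_support_def
  by (subst prod.reindex) (auto simp: inj_on_def intro!: prod.mono_neutral_cong_left)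

lemma card_pauli_letters: "card (pauli_letters P) = card (pauli_support P)"
  unfolding pauli_letters_def by (rule card_image) (simp add: inj_on_def)

lemma pauli_letters_eq_empty_iff: "pauli_letters P = {} \<longleftrightarrow> P = (\<lambda>_. PI)"
  by (auto simp: pauli_letters_def pauli_support_def fun_eq_iff)

text \<open>Each letter brings the factor \<open>1 / sqrt 3\<close> of its Bloch component. Sets
  that come from no string, such as those with two letters at one qubit, get coefficient 0.\<close>

definition letters_coeff :: "'q::finite qop \<Rightarrow> ('q \<times> pauli) set \<Rightarrow> real" where
  "letters_coeff A S = (if S \<in> range pauli_letters
     then Re (pauli_coeff A (inv pauli_letters S)) / sqrt 3 ^ card S else 0)"

lemma letters_coeff_pauli_letters:
  "letters_coeff A (pauli_letters P) = Re (pauli_coeff A P) / sqrt 3 ^ card (pauli_support P)"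
  by (simp add: letters_coeff_def inj_pauli_letters card_pauli_letters)

lemma letters_coeff_nonzeroE:
  assumes "letters_coeff A S \<noteq> 0"
  obtains P where "S = pauli_letters P" "pauli_coeff A P \<noteq> 0"
proof -
  obtain P where P: "S = pauli_letters P"
    using assms by (auto simp: letters_coeff_def split: if_splits)
  then have "pauli_coeff A P \<noteq> 0"
    using assms by (auto simp: letters_coeff_pauli_letters)
  with P show thesis by (rule that)
qed

lemma sum_letters:
  fixes f :: "('q::finite \<times> pauli) set \<Rightarrow> real"
  assumes "\<And>S. S \<notin> range pauli_letters \<Longrightarrow> f S = 0"
  shows "(\<Sum>S\<in>UNIV. f S) = (\<Sum>P\<in>UNIV. f (pauli_letters P))"
proof -
  have "(\<Sum>S\<in>UNIV. f S) = (\<Sum>S\<in>range pauli_letters. f S)"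
    using assms by (intro sum.mono_neutral_right) auto
  also have "\<dots> = (\<Sum>P\<in>UNIV. f (pauli_letters P))"
    by (simp add: sum.reindex[OF inj_pauli_letters])
  finally show ?thesis .
qed

text \<open>
  The left-hand side is the expectation of \<open>H\<close> in the pure product state whose Bloch vector at
  qubit \<open>q\<close> is \<open>(\<plusminus>1, \<plusminus>1, \<plusminus>1) / sqrt 3\<close>, with the signs prescribed by \<open>X\<close>.
\<close>

lemma multilinear_letters_coeff_le:
  fixes H :: "'q::finite qop"
  assumes "hermitian H"
  shows "\<bar>multilinear UNIV (letters_coeff H) (sign_vec X)\<bar> \<le> spectral_norm H"
proof -
  define r where "r q p = sign_vec X (q, p) / sqrt 3" for q p
  have sq: "(r q p)\<^sup>2 = 1 / 3" for q p
    by (simp add: r_def sign_vec_def power_divide)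
  have "r q p > - 1" for q p
    by (auto simp: r_def sign_vec_def intro: less_trans[of _ 0])
  then have "\<exists>\<psi>. (\<Sum>a\<in>UNIV. (cmod (\<psi> a))\<^sup>2) = 1 \<and>
      (\<forall>p. (\<Sum>a\<in>UNIV. \<Sum>b\<in>UNIV. cnj (\<psi> a) * pauli_matrix p $ a $ b * \<psi> b)
        = of_real (if p = PI then 1 else r q p))" for q
    by (intro ex_qubit_state) (simp_all add: sq)
  then have "\<exists>\<psi>. \<forall>q. (\<Sum>a\<in>UNIV. (cmod (\<psi> q a))\<^sup>2) = 1 \<and>
      (\<forall>p. (\<Sum>a\<in>UNIV. \<Sum>b\<in>UNIV. cnj (\<psi> q a) * pauli_matrix p $ a $ b * \<psi> q b)
        = of_real (if p = PI then 1 else r q p))"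
    by (intro choice allI)
  then obtain \<psi> where n: "\<And>q. (\<Sum>a\<in>UNIV. (cmod (\<psi> q a))\<^sup>2) = 1"
    and e: "\<And>q p. (\<Sum>a\<in>UNIV. \<Sum>b\<in>UNIV. cnj (\<psi> q a) * pauli_matrix p $ a $ b * \<psi> q b)
        = of_real (if p = PI then 1 else r q p)"
    by blast
  have "multilinear UNIV (letters_coeff H) (sign_vec X)
      = (\<Sum>P\<in>UNIV. letters_coeff H (pauli_letters P) * (\<Prod>v\<in>pauli_letters P. sign_vec X v))"
    unfolding multilinear_def Pow_UNIV by (rule sum_letters) (simp add: letters_coeff_def)
  also have "\<dots> = (\<Sum>P\<in>UNIV. Re (pauli_coeff H P) * (\<Prod>q\<in>UNIV. if P q = PI then 1 else r q (P q)))"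
  proof (intro sum.cong refl)
    fix P :: "'q \<Rightarrow> pauli"
    have "(\<Prod>q\<in>UNIV. if P q = PI then 1 else r q (P q)) = (\<Prod>v\<in>pauli_letters P. sign_vec X v / sqrt 3)"
      by (simp add: prod_pauli_letters r_def cong: if_cong)
    also have "\<dots> = (\<Prod>v\<in>pauli_letters P. sign_vec X v) / sqrt 3 ^ card (pauli_support P)"
      by (simp add: prod_dividef card_pauli_letters)
    finally show "letters_coeff H (pauli_letters P) * (\<Prod>v\<in>pauli_letters P. sign_vec X v)
        = Re (pauli_coeff H P) * (\<Prod>q\<in>UNIV. if P q = PI then 1 else r q (P q))"
      by (simp add: letters_coeff_pauli_letters)
  qed
  also have "of_real \<dots> = expect H (product_state \<psi>)"
    unfolding expect_pauli_expansion[of H] expect_pauli_op e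
    by (simp add: of_real_Re[OF pauli_coeff_real[OF assms]])
  finally have "\<bar>multilinear UNIV (letters_coeff H) (sign_vec X)\<bar> = cmod (expect H (product_state \<psi>))"
    by (metis norm_of_real real_norm_def)
  also have "\<dots> \<le> spectral_norm H"
    by (intro cmod_expect_le norm_product_state n)
  finally show ?thesis .
qed

section \<open>Constants and the final estimate\<close>

text \<open>From 10 on, \<open>k ^ k\<close> dominates \<open>10 ^ k\<close>; the smaller cases are
  computed. The tightest is \<open>k = 1\<close>, with 20 against 27.\<close>

lemma two_mult_ten_power_le: "k \<ge> 1 \<Longrightarrow> 2 * 10 ^ k \<le> 27 * k ^ (k + 5)" for k :: nat
proof (cases "k \<ge> 10")
  case True
  then have "2 * 10 ^ k * 1 \<le> 27 * k ^ k * k ^ 5"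
    by (intro mult_mono power_mono) auto
  then show ?thesis by (simp add: power_add)
next
  case False
  moreover assume "k \<ge> 1"
  ultimately have "k = 1 \<or> k = 2 \<or> k = 3 \<or> k = 4 \<or> k = 5 \<or> k = 6 \<or> k = 7 \<or> k = 8 \<or> k = 9"
    by linarith
  then show ?thesis
    by (elim disjE) simp_all
qed

text \<open>After squaring, the claim follows from \<open>fact k \<le> k ^ k\<close>, from
  \<open>36\<^sup>2 \<le> 10 * B\<^sup>2\<close> and from the preceding integer inequality.\<close>

lemma pauli_const_le:
  assumes "k \<ge> 1" and "d \<ge> 1"
  shows "pauli_const k d * (sqrt d * 36 ^ k) \<le> 3 * sqrt 3"
proof -
  define B where "B = 2 * sqrt 6 + 4 * sqrt (3::real)"
  have B: "B > 0"
    by (simp add: B_def add_pos_pos)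
  have "sqrt 6 * sqrt 3 = 3 * sqrt (2::real)"
    using real_sqrt_mult[of "9" 2] by (simp flip: real_sqrt_mult)
  then have "B\<^sup>2 = 72 + 48 * sqrt 2"
    by (simp add: B_def power2_sum)
  \<comment> \<open>The value 1.2 is just enough: \<open>72 + 48 * 1.2 = 129.6\<close>, a tenth of
    1296.\<close>
  moreover have "sqrt 2 \<ge> (1.2 :: real)"
    by (intro real_le_rsqrt) (simp add: power2_eq_square)
  ultimately have B2: "1296 \<le> 10 * B\<^sup>2"
    by simp
  have kpos: "real k > 0"
    using assms(1) by simp
  \<comment> \<open>The exponent \<open>2 * k + 5\<close> is split so that \<open>k ^ k\<close>
    absorbs the factorial and \<open>k ^ (k + 5)\<close> absorbs \<open>2 * 10 ^ k\<close>.\<close>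
  have kp: "(real k powr (real k + 5 / 2))\<^sup>2 = real k ^ k * real k ^ (k + 5)"
  proof -
    have "(real k powr (real k + 5 / 2))\<^sup>2 = real k powr (real (k + (k + 5)))"
      using assms(1) by (simp add: powr_power)
    then show ?thesis
      by (simp only: powr_realpow[OF kpos] power_add)
  qed
  have power_swap: "(x ^ k)\<^sup>2 = (x\<^sup>2) ^ k" for x :: real
    by (simp only: power_mult[symmetric] mult.commute)
  have "(sqrt (2 * fact k) * 36 ^ k)\<^sup>2 = 2 * fact k * 1296 ^ k"
    unfolding power_mult_distrib power_swap by simp
  also have "\<dots> \<le> 2 * real k ^ k * (10 * B\<^sup>2) ^ k"
    using B2 fact_le_power[of k, where 'a = real] by (intro mult_mono power_mono) auto
  also have "\<dots> = (2 * 10 ^ k) * (real k ^ k * (B ^ k)\<^sup>2)"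
    unfolding power_swap power_mult_distrib by simp
  also have "\<dots> \<le> (27 * real k ^ (k + 5)) * (real k ^ k * (B ^ k)\<^sup>2)"
  proof (rule mult_right_mono)
    have "real (2 * 10 ^ k) \<le> real (27 * k ^ (k + 5))"
      using two_mult_ten_power_le[OF assms(1)] by (rule of_nat_mono)
    then show "2 * 10 ^ k \<le> 27 * real k ^ (k + 5)"
      by simp
  qed simp
  also have "\<dots> = (3 * sqrt 3 * (real k powr (real k + 5 / 2) * B ^ k))\<^sup>2"
    unfolding power_mult_distrib kp by simp
  finally have "sqrt (2 * fact k) * 36 ^ k \<le> 3 * sqrt 3 * (real k powr (real k + 5 / 2) * B ^ k)"
    by (rule power2_le_imp_le) (use B in simp)
  then show ?thesis
    using assms B unfolding pauli_const_def B_def[symmetric]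
    by (simp add: pos_divide_le_eq)
qed

text \<open>The factors are \<open>sqrt 3 ^ k\<close> for undoing the Bloch scaling,
  \<open>2 ^ k\<close> for the split, \<open>2 ^ k * sqrt d\<close> for the sparsity,
  \<open>3 ^ (k - 1)\<close> for the first moment and at most \<open>sqrt 3 ^ (k - 1)\<close> for
  the linear coefficient.\<close>

lemma sum_pauli_coeff_le:
  fixes H :: "'q::finite qop"
  assumes "k \<ge> 1" and H: "local_hamiltonian k d H"
  shows "(\<Sum>P\<in>- {\<lambda>_. PI}. cmod (pauli_coeff H P)) \<le> sqrt d * 36 ^ k / (3 * sqrt 3) * spectral_norm H"
proof -
  have herm: "hermitian H"
    using H by (simp add: local_hamiltonian_def)
  let ?M = "spectral_norm H"
  have M: "?M \<ge> 0"
    by (intro onorm_pos_le matrix_vector_mul_bounded_linear)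
  have sum: "(\<Sum>S\<in>- {{}}. \<bar>letters_coeff H S\<bar>)
      \<le> 2 ^ k * sqrt (4 ^ k * d :: nat) * 3 ^ (k - 1) * 3 ^ ((k - 1) div 2) * ?M"
  proof (rule multilinear_coeff_sum[OF assms(1)])
    show "card S \<le> k" if "letters_coeff H S \<noteq> 0" for S
      using that by (elim letters_coeff_nonzeroE) (simp add: card_pauli_letters local_hamiltonian_pauli(1)[OF H])
    show "card {S. v \<in> S \<and> letters_coeff H S \<noteq> 0} \<le> 4 ^ k * d" for v
    proof -
      have "{S. v \<in> S \<and> letters_coeff H S \<noteq> 0}
          \<subseteq> pauli_letters ` {P. pauli_coeff H P \<noteq> 0 \<and> fst v \<in> pauli_support P}"
        by (auto elim!: letters_coeff_nonzeroE simp: pauli_letters_def)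
      then have "card {S. v \<in> S \<and> letters_coeff H S \<noteq> 0}
          \<le> card {P. pauli_coeff H P \<noteq> 0 \<and> fst v \<in> pauli_support P}"
        by (rule surj_card_le[rotated]) simp
      then show ?thesis
        using local_hamiltonian_pauli(2)[OF H, of "fst v"] by linarith
    qed
  qed (rule multilinear_letters_coeff_le[OF herm])
  have "(\<Sum>P\<in>- {\<lambda>_. PI}. cmod (pauli_coeff H P))
      \<le> (\<Sum>P\<in>- {\<lambda>_. PI}. sqrt 3 ^ k * \<bar>letters_coeff H (pauli_letters P)\<bar>)"
  proof (rule sum_mono)
    fix P
    have "pauli_coeff H P = of_real (Re (pauli_coeff H P))"
      using pauli_coeff_real[OF herm] by simp
    then have "cmod (pauli_coeff H P) = \<bar>Re (pauli_coeff H P)\<bar>"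
      by (metis norm_of_real)
    then have "cmod (pauli_coeff H P) = sqrt 3 ^ card (pauli_support P) * \<bar>letters_coeff H (pauli_letters P)\<bar>"
      by (simp add: letters_coeff_pauli_letters)
    also have "\<dots> \<le> sqrt 3 ^ k * \<bar>letters_coeff H (pauli_letters P)\<bar>"
    proof (cases "pauli_coeff H P = 0")
      case False
      then show ?thesis
        using local_hamiltonian_pauli(1)[OF H, of P] by (intro mult_right_mono power_increasing) auto
    qed (simp add: letters_coeff_pauli_letters)
    finally show "cmod (pauli_coeff H P) \<le> sqrt 3 ^ k * \<bar>letters_coeff H (pauli_letters P)\<bar>" .
  qed
  also have "\<dots> = sqrt 3 ^ k * (\<Sum>S\<in>pauli_letters ` (- {\<lambda>_. PI}). \<bar>letters_coeff H S\<bar>)"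
    by (simp add: sum_distrib_left sum.reindex[OF inj_on_subset[OF inj_pauli_letters]])
  also have "\<dots> \<le> sqrt 3 ^ k * (\<Sum>S\<in>- {{}}. \<bar>letters_coeff H S\<bar>)"
    by (intro mult_left_mono sum_mono2) (auto simp: pauli_letters_eq_empty_iff dest: sym)
  also have "\<dots> \<le> sqrt 3 ^ k * (2 ^ k * sqrt (4 ^ k * d :: nat) * 3 ^ (k - 1) * 3 ^ ((k - 1) div 2) * ?M)"
    by (intro mult_left_mono sum) simp
  also have "\<dots> \<le> sqrt 3 ^ k * (2 ^ k * sqrt (4 ^ k * d :: nat) * 3 ^ (k - 1) * sqrt 3 ^ (k - 1) * ?M)"
  proof -
    have "(3 :: real) ^ ((k - 1) div 2) = sqrt 3 ^ (2 * ((k - 1) div 2))"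
      by (simp add: power_mult)
    also have "\<dots> \<le> sqrt 3 ^ (k - 1)"
      by (intro power_increasing) auto
    finally show ?thesis
      using M by (intro mult_left_mono mult_right_mono) auto
  qed
  also have "\<dots> = sqrt d * 36 ^ k / (3 * sqrt 3) * ?M"
  proof -
    obtain l where k: "k = Suc l"
      using assms(1) by (cases k) auto
    have "sqrt (4 ^ k) = (2 :: real) ^ k"
      by (simp add: real_sqrt_power)
    moreover have "(2 ^ k * 2 ^ k * 3 ^ k * (sqrt 3 ^ k * sqrt 3 ^ k) :: real) = 36 ^ k"
      by (simp flip: power_mult_distrib)
    ultimately show ?thesis
      unfolding k by (simp add: real_sqrt_mult field_simps)
  qed
  finally show ?thesis .
qed

text \<open>At the centre of the cube only the empty monomial survives, and its coefficient is that
  of the identity string.\<close>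

lemma cmod_pauli_coeff_identity_le:
  fixes H :: "'q::finite qop"
  assumes "hermitian H"
  shows "cmod (pauli_coeff H (\<lambda>_. PI)) \<le> spectral_norm H"
proof -
  have empty: "pauli_letters (\<lambda>_::'q. PI) = {}"
    by (simp add: pauli_letters_eq_empty_iff)
  have "letters_coeff H S * (\<Prod>v\<in>S. 0) = (if S = {} then letters_coeff H S else 0)" for S
    by auto
  then have "multilinear UNIV (letters_coeff H) (\<lambda>_. 0) = letters_coeff H {}"
    unfolding multilinear_def by simp
  moreover have "\<bar>multilinear UNIV (letters_coeff H) (\<lambda>_. 0)\<bar> \<le> spectral_norm H"
    by (rule multilinear_cube_bound) (simp_all add: multilinear_letters_coeff_le[OF assms])
  moreover have "letters_coeff H {} = Re (pauli_coeff H (\<lambda>_. PI))"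
    using letters_coeff_pauli_letters[of H "\<lambda>_. PI"] by (simp add: empty pauli_support_def)
  moreover have "pauli_coeff H (\<lambda>_. PI) = of_real (Re (pauli_coeff H (\<lambda>_. PI)))"
    using pauli_coeff_real[OF assms] by simp
  ultimately show ?thesis
    by (metis norm_of_real)
qed

theorem corollary12:
  fixes H :: "'q::finite qop" and k d :: nat
  assumes "k \<ge> 1" and "d \<ge> 1"
    and "local_hamiltonian k d H"
  shows "1 / 3 * pauli_const k d * pauli_norm1 H \<le> spectral_norm H"
proof -
  let ?M = "spectral_norm H" and ?C = "pauli_const k d"
  \<comment> \<open>\<open>R\<close> is the factor bounding the non-identity part. Since
    \<open>R \<ge> 1\<close>, it also covers the identity coefficient; the two parts together cost a
    factor 2, within the 3 of the claim.\<close>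
  define R where "R = sqrt d * 36 ^ k / (3 * sqrt 3)"
  have M: "?M \<ge> 0"
    by (intro onorm_pos_le matrix_vector_mul_bounded_linear)
  have C: "?C \<ge> 0"
    by (simp add: pauli_const_def)
  have CR: "?C * R \<le> 1"
    using pauli_const_le[OF assms(1,2)] by (simp add: R_def)
  have "sqrt 3 \<le> (2::real)"
    by (simp add: real_le_lsqrt)
  moreover have "(36::real) ^ 1 \<le> 36 ^ k"
    using assms(1) by (intro power_increasing) auto
  moreover have "1 * 36 ^ k \<le> sqrt d * 36 ^ k"
    using assms(2) by (intro mult_right_mono) auto
  ultimately have "3 * sqrt 3 \<le> sqrt d * 36 ^ k"
    unfolding power_one_right mult_1 by linarith
  then have "R \<ge> 1"
    by (simp add: R_def)
  have "pauli_norm1 H = cmod (pauli_coeff H (\<lambda>_. PI)) + (\<Sum>P\<in>- {\<lambda>_. PI}. cmod (pauli_coeff H P))"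
    unfolding pauli_norm1_def by (simp add: sum.remove[of UNIV "\<lambda>_. PI"] Compl_eq_Diff_UNIV)
  also have "\<dots> \<le> R * ?M + R * ?M"
  proof (rule add_mono)
    have "cmod (pauli_coeff H (\<lambda>_. PI)) \<le> 1 * ?M"
      using cmod_pauli_coeff_identity_le[of H] assms(3) by (simp add: local_hamiltonian_def)
    also have "\<dots> \<le> R * ?M"
      using \<open>R \<ge> 1\<close> M by (rule mult_right_mono)
    finally show "cmod (pauli_coeff H (\<lambda>_. PI)) \<le> R * ?M" .
  qed (use sum_pauli_coeff_le[OF assms(1,3)] in \<open>simp add: R_def\<close>)
  finally have "?C * pauli_norm1 H \<le> ?C * (2 * (R * ?M))"
    using C by (intro mult_left_mono) simp_all
  also have "\<dots> = 2 * (?C * R * ?M)"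
    by simp
  also have "\<dots> \<le> 2 * (1 * ?M)"
    using mult_right_mono[OF CR M] by simp
  also have "\<dots> \<le> 3 * ?M"
    using M by simp
  finally show ?thesis
    by simp
qed

end
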